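(* Let $\{l_{\mathrm R}(i)\in\{0,1\}\}_{i\in\mathbb{N}_0}$ be a time-inhomogeneous Markov chain with transition probabilities $p_{q,r}(i)$, and let $p_1\in(0,1)$ satisfy $p_{q,1}(i)\le p_1$ for all $q\in\{0,1\}$, $i\in\mathbb{N}_0$. Then $$\sum_{k=1}^{\infty}\mathbb{P}\Big[\sum_{i=0}^{k-1}l_{\mathrm R}(i)>\rho_{\mathrm R}k\Big]<\infty\quad\text{for all }\rho_{\mathrm R}\in(p_1,1).$$
   Context: $\mathbb{N}_0$ denotes the nonnegative integers. The time-inhomogeneous Markov chain $\{l_{\mathrm R}(i)\}$ has an arbitrary initial distribution on $\{0,1\}$ and transition probabilities $p_{q,r}:\mathbb{N}_0\to[0,1]$, $\mathbb{P}[l_{\mathrm R}(i+1)=r\mid l_{\mathrm R}(i)=q]=p_{q,r}(i)$, $q,r\in\{0,1\}$. *)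

theory Defs
  imports "HOL-Probability.Probability"
begin

text \<open>
  A discrete-time Markov chain with countable state space S, where
  p q r i is the probability of moving from q at time i to r at
  time i + 1. The conditional equations are only required when
  the conditioning event has positive probability, since the library sets
  conditional probabilities given a null event to 0. The initial distribution
  is unconstrained. Row sums being 1 follows from
  transition_prob for every state q with positive probability
  at time i; at other states only membership in [0,1] is imposed.
\<close>

locale inhomogeneous_markov_chain = prob_space M
  for M :: "'a measure" +
  fixes S :: "'s set"
    and p :: "'s \<Rightarrow> 's \<Rightarrow> nat \<Rightarrow> real"
    and X :: "nat \<Rightarrow> 'a \<Rightarrow> 's"
  assumes countable_states: "countable S"
    and random_variable_state: "X i \<in> measurable M (count_space S)"
    and transition_range: "q \<in> S \<Longrightarrow> r \<in> S \<Longrightarrow> p q r i \<in> {0..1}"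
    and markov_property:
      "\<lbrakk>\<And>j. j \<le> i \<Longrightarrow> x j \<in> S; r \<in> S; \<P>(\<omega> in M. \<forall>j\<le>i. X j \<omega> = x j) > 0\<rbrakk> \<Longrightarrow>
        \<P>(\<omega> in M. X (i + 1) \<omega> = r \<bar> \<forall>j\<le>i. X j \<omega> = x j) =
        \<P>(\<omega> in M. X (i + 1) \<omega> = r \<bar> X i \<omega> = x i)"
    and transition_prob:
      "\<lbrakk>q \<in> S; r \<in> S; \<P>(\<omega> in M. X i \<omega> = q) > 0\<rbrakk> \<Longrightarrow>
        \<P>(\<omega> in M. X (i + 1) \<omega> = r \<bar> X i \<omega> = q) = p q r i"

end

theory Submission
  imports Defs
begin

text \<open>
  Chernoff bound: conditioned on any history, the next state is 1 with probability at most
  \<open>p\<^sub>1\<close>, so each step multiplies the exponential moment of the partial sum by at most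
  \<open>1 + (e\<^sup>t - 1) p\<^sub>1\<close>, except the first one, where the arbitrary initial distribution
  costs a factor \<open>e\<^sup>t\<close>. As \<open>p\<^sub>1 < \<rho>\<^sub>R\<close>, some small \<open>t > 0\<close> makes
  \<open>(1 + (e\<^sup>t - 1) p\<^sub>1) e\<^sup>-\<^sup>t\<^sup>\<rho> < 1\<close>, and the tail probabilities decay geometrically.
\<close>

lemma (in inhomogeneous_markov_chain) state_in:
  assumes "\<omega> \<in> space M"
  shows "X i \<omega> \<in> S"
  using measurable_space[OF random_variable_state assms] by simp

lemma (in inhomogeneous_markov_chain) sets_state_eq:
  "{\<omega> \<in> space M. X i \<omega> = q} \<in> events"
proof -
  \<comment> \<open>\<open>q\<close> may lie outside \<open>S\<close>; intersecting with
    \<open>S\<close> gives a set of \<open>count_space S\<close> with the same preimage.\<close>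
  have "{\<omega> \<in> space M. X i \<omega> = q} = X i -` ({q} \<inter> S) \<inter> space M"
    using state_in by auto
  also have "\<dots> \<in> events"
    by (rule measurable_sets[OF random_variable_state]) simp
  finally show ?thesis .
qed

lemma (in inhomogeneous_markov_chain) sets_history_eq:
  "{\<omega> \<in> space M. \<forall>j\<le>(i::nat). X j \<omega> = x j} \<in> events"
  using sets.sets_Collect_finite_All'[of "{..i}" M "\<lambda>j \<omega>. X j \<omega> = x j"] sets_state_eq
  by (simp add: Ball_def)

text \<open>In product form the bound also covers null histories, where both sides vanish. For a
  history of positive probability, the Markov property reduces the conditional probability to a
  transition probability.\<close>

lemma (in inhomogeneous_markov_chain) prob_history_step_le:
  assumes x: "\<And>j. j \<le> i \<Longrightarrow> x j \<in> S" and r: "r \<in> S" and le: "p (x i) r i \<le> c"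
  shows "\<P>(\<omega> in M. X (i + 1) \<omega> = r \<and> (\<forall>j\<le>i. X j \<omega> = x j))
    \<le> c * \<P>(\<omega> in M. \<forall>j\<le>i. X j \<omega> = x j)"
proof (cases "\<P>(\<omega> in M. \<forall>j\<le>i. X j \<omega> = x j) = 0")
  case True
  have "\<P>(\<omega> in M. X (i + 1) \<omega> = r \<and> (\<forall>j\<le>i. X j \<omega> = x j))
      \<le> \<P>(\<omega> in M. \<forall>j\<le>i. X j \<omega> = x j)"
    by (rule finite_measure_mono[OF _ sets_history_eq]) auto
  with True show ?thesis by simp
next
  case False
  then have pos: "\<P>(\<omega> in M. \<forall>j\<le>i. X j \<omega> = x j) > 0"
    by (simp add: zero_less_measure_iff)
  \<comment> \<open>\<open>transition_prob\<close> needs the last state to have positive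
    probability; it inherits this from the history.\<close>
  also have "\<dots> \<le> \<P>(\<omega> in M. X i \<omega> = x i)"
    by (rule finite_measure_mono[OF _ sets_state_eq]) auto
  finally have "\<P>(\<omega> in M. X (i + 1) \<omega> = r \<bar> \<forall>j\<le>i. X j \<omega> = x j) = p (x i) r i"
    using markov_property[OF x r pos] transition_prob[OF x r, of i i] by simp
  with le pos show ?thesis
    by (simp add: cond_prob_def divide_simps split: if_splits)
qed

text \<open>Over a finite state space only finitely many histories up to time \<open>i\<close>
  exist, so a function of the history is a simple function. Its expectation is a finite sum with
  nonnegative weights \<open>g x\<close>, and the bound for single histories can be added
  up.\<close>

lemma (in inhomogeneous_markov_chain) expectation_history_step_le:
  fixes g :: "(nat \<Rightarrow> 's) \<Rightarrow> real"
  assumes S: "finite S" and r: "r \<in> S" and le: "\<And>q. q \<in> S \<Longrightarrow> p q r i \<le> c"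
    and g: "\<And>h. g h \<ge> 0"
  defines "hist \<equiv> \<lambda>\<omega>. restrict (\<lambda>j. X j \<omega>) {..i}"
  shows "integrable M (\<lambda>\<omega>. g (hist \<omega>))"
    and "integrable M (\<lambda>\<omega>. g (hist \<omega>) * indicator {r} (X (i + 1) \<omega>))"
    and "expectation (\<lambda>\<omega>. g (hist \<omega>) * indicator {r} (X (i + 1) \<omega>))
      \<le> c * expectation (\<lambda>\<omega>. g (hist \<omega>))"
proof -
  \<comment> \<open>\<open>restrict\<close> fixes the values beyond \<open>i\<close>, so histories
    range over this finite set and are equal as functions exactly when they agree up to
    \<open>i\<close>.\<close>
  define H where "H = PiE {..i} (\<lambda>_. S)"
  define A where "A x = {\<omega> \<in> space M. \<forall>j\<le>i. X j \<omega> = x j}" for x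
  define B where "B x = {\<omega> \<in> space M. X (i + 1) \<omega> = r \<and> (\<forall>j\<le>i. X j \<omega> = x j)}" for x
  have H: "finite H" unfolding H_def by (intro finite_PiE) (use S in auto)
  have A [measurable]: "A x \<in> events" for x unfolding A_def by (rule sets_history_eq)
  have "B x = {\<omega> \<in> space M. X (i + 1) \<omega> = r} \<inter> A x" for x
    unfolding A_def B_def by auto
  then have B [measurable]: "B x \<in> events" for x
    using sets_state_eq[of "i + 1" r] by simp
  have histH: "hist \<omega> \<in> H" if "\<omega> \<in> space M" for \<omega>
    using state_in[OF that] by (auto simp: H_def hist_def)
  have histA: "\<omega> \<in> A x \<longleftrightarrow> hist \<omega> = x" if "\<omega> \<in> space M" "x \<in> H" for \<omega> x
  proof
    assume "\<omega> \<in> A x"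
    show "hist \<omega> = x"
      by (rule PiE_ext[of _ "{..i}" "\<lambda>_. S"])
        (use \<open>\<omega> \<in> A x\<close> histH that in \<open>auto simp: H_def A_def hist_def\<close>)
  qed (use that in \<open>auto simp: A_def hist_def\<close>)
  have eqA: "g (hist \<omega>) = (\<Sum>x\<in>H. g x * indicator (A x) \<omega>)" if "\<omega> \<in> space M" for \<omega>
  proof -
    have "(\<Sum>x\<in>H. g x * indicator (A x) \<omega>) = (\<Sum>x\<in>H. if hist \<omega> = x then g x else 0)"
      using histA[OF that] by (intro sum.cong) (auto simp: indicator_def)
    then show ?thesis using H histH[OF that] by simp
  qed
  have eqB: "g (hist \<omega>) * indicator {r} (X (i + 1) \<omega>) = (\<Sum>x\<in>H. g x * indicator (B x) \<omega>)"
    if "\<omega> \<in> space M" for \<omega>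
    unfolding eqA[OF that] sum_distrib_right
    using that by (intro sum.cong) (auto simp: A_def B_def indicator_def)
  have int: "integrable M (\<lambda>\<omega>. \<Sum>x\<in>H. g x * indicator (A x) \<omega>)"
      "integrable M (\<lambda>\<omega>. \<Sum>x\<in>H. g x * indicator (B x) \<omega>)"
    by (auto intro!: Bochner_Integration.integrable_sum integrable_mult_right
        simp: less_top[symmetric])
  show "integrable M (\<lambda>\<omega>. g (hist \<omega>))"
    using int(1) by (subst Bochner_Integration.integrable_cong[OF refl eqA])
  show "integrable M (\<lambda>\<omega>. g (hist \<omega>) * indicator {r} (X (i + 1) \<omega>))"
    using int(2) by (subst Bochner_Integration.integrable_cong[OF refl eqB])
  have EA: "expectation (\<lambda>\<omega>. g (hist \<omega>)) = (\<Sum>x\<in>H. g x * prob (A x))"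
    by (subst Bochner_Integration.integral_cong[OF refl eqA], assumption)
      (subst Bochner_Integration.integral_sum, auto simp: less_top[symmetric] A)
  have EB: "expectation (\<lambda>\<omega>. g (hist \<omega>) * indicator {r} (X (i + 1) \<omega>))
      = (\<Sum>x\<in>H. g x * prob (B x))"
    by (subst Bochner_Integration.integral_cong[OF refl eqB], assumption)
      (subst Bochner_Integration.integral_sum, auto simp: less_top[symmetric] B)
  have "(\<Sum>x\<in>H. g x * prob (B x)) \<le> (\<Sum>x\<in>H. g x * (c * prob (A x)))"
  proof (intro sum_mono mult_left_mono g)
    fix x assume "x \<in> H"
    then have "x j \<in> S" if "j \<le> i" for j using that by (auto simp: H_def)
    then show "prob (B x) \<le> c * prob (A x)"
      unfolding A_def B_def using prob_history_step_le[of i x r c] r le by simp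
  qed
  then show "expectation (\<lambda>\<omega>. g (hist \<omega>) * indicator {r} (X (i + 1) \<omega>))
      \<le> c * expectation (\<lambda>\<omega>. g (hist \<omega>))"
    unfolding EA EB by (simp add: sum_distrib_left mult_ac)
qed

text \<open>Induction on time: since \<open>z \<ge> 1\<close>, the step bound with \<open>g\<close>
  the power of \<open>z\<close> multiplies the moment by at most \<open>1 + (z - 1) * c\<close>. The
  leading \<open>z\<close> bounds the moment of \<open>l 0\<close>, about whose law nothing is
  known.\<close>

lemma exponential_moment_le:
  fixes z c :: real and l :: "nat \<Rightarrow> 'a \<Rightarrow> nat"
  assumes chain: "inhomogeneous_markov_chain M {0, 1} p l"
    and c: "0 \<le> c" and le: "\<And>q i. q \<in> {0, 1} \<Longrightarrow> p q 1 i \<le> c" and z: "1 \<le> z"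
  shows "integrable M (\<lambda>\<omega>. z ^ (\<Sum>j\<le>i. l j \<omega>))
    \<and> (\<integral>\<omega>. z ^ (\<Sum>j\<le>i. l j \<omega>) \<partial>M) \<le> z * (1 + (z - 1) * c) ^ i"
proof -
  interpret inhomogeneous_markov_chain M "{0, 1}" p l by (rule chain)
  define h where "h i \<omega> = restrict (\<lambda>j. l j \<omega>) {..i}" for i :: nat and \<omega>
  define g where "g i x = z ^ (\<Sum>j\<le>i. x j)" for i :: nat and x :: "nat \<Rightarrow> nat"
  have g: "g i x \<ge> 0" for i x using z by (simp add: g_def)
  have gh: "g i (h i \<omega>) = z ^ (\<Sum>j\<le>i. l j \<omega>)" for i \<omega> by (simp add: g_def h_def)
  have l01: "l i \<omega> = 0 \<or> l i \<omega> = 1" if "\<omega> \<in> space M" for i \<omega>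
    using state_in[OF that, of i] by auto
  have ints: "integrable M (\<lambda>\<omega>. z ^ (\<Sum>j\<le>i. l j \<omega>))"
      "integrable M (\<lambda>\<omega>. z ^ (\<Sum>j\<le>i. l j \<omega>) * indicator {1} (l (i + 1) \<omega>))"
      "expectation (\<lambda>\<omega>. z ^ (\<Sum>j\<le>i. l j \<omega>) * indicator {1} (l (i + 1) \<omega>))
        \<le> c * expectation (\<lambda>\<omega>. z ^ (\<Sum>j\<le>i. l j \<omega>))" for i
    using expectation_history_step_le[where g = "g i" and r = 1 and c = c and i = i] le g
    by (simp_all add: h_def[symmetric] gh)
  show ?thesis
  proof (induction i)
    case 0
    have "(\<integral>\<omega>. z ^ (\<Sum>j\<le>0. l j \<omega>) \<partial>M) \<le> (\<integral>\<omega>. z \<partial>M)"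
    proof (rule integral_mono[OF ints(1)])
      fix \<omega> assume "\<omega> \<in> space M"
      with l01[of \<omega> 0] z show "z ^ (\<Sum>j\<le>0. l j \<omega>) \<le> z" by auto
    qed auto
    with ints(1)[of 0] show ?case by (simp add: prob_space)
  next
    case (Suc i)
    let ?E = "expectation (\<lambda>\<omega>. z ^ (\<Sum>j\<le>i. l j \<omega>))"
    \<comment> \<open>For a state in {0, 1} the power of \<open>z\<close> is affine in the indicator
      of state 1, so only the product with that indicator has to be estimated.\<close>
    have eq: "z ^ (\<Sum>j\<le>Suc i. l j \<omega>) = z ^ (\<Sum>j\<le>i. l j \<omega>)
        + (z - 1) * (z ^ (\<Sum>j\<le>i. l j \<omega>) * indicator {1} (l (i + 1) \<omega>))"
      if "\<omega> \<in> space M" for \<omega>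
      using l01[OF that, of "i + 1"] by (auto simp: power_add algebra_simps)
    have "expectation (\<lambda>\<omega>. z ^ (\<Sum>j\<le>Suc i. l j \<omega>))
        = ?E + (z - 1) * expectation (\<lambda>\<omega>. z ^ (\<Sum>j\<le>i. l j \<omega>) * indicator {1} (l (i + 1) \<omega>))"
      by (subst Bochner_Integration.integral_cong[OF refl eq], assumption)
        (simp only: Bochner_Integration.integral_add integrable_mult_right ints integral_mult_right_zero)
    also have "\<dots> \<le> ?E + (z - 1) * (c * ?E)"
      using z by (intro add_left_mono mult_left_mono ints(3)) auto
    also have "\<dots> = ?E * (1 + (z - 1) * c)" by (simp add: algebra_simps)
    also have "\<dots> \<le> z * (1 + (z - 1) * c) ^ i * (1 + (z - 1) * c)"
      using Suc.IH z c by (intro mult_right_mono) auto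
    finally have "expectation (\<lambda>\<omega>. z ^ (\<Sum>j\<le>Suc i. l j \<omega>)) \<le> z * (1 + (z - 1) * c) ^ Suc i"
      by (simp only: power_Suc mult_ac)
    with ints(1) show ?case by blast
  qed
qed

text \<open>At \<open>t = 0\<close> the expression equals 1 and has derivative
  \<open>a - b < 0\<close>, so it drops below 1 immediately to the right of 0.\<close>

lemma exists_chernoff_exponent:
  fixes a b :: real
  assumes "a < b"
  shows "\<exists>t>0. (1 + (exp t - 1) * a) * exp (- (t * b)) < 1"
proof -
  have "((\<lambda>t. (1 + (exp t - 1) * a) * exp (- (t * b))) has_real_derivative a - b) (at 0)"
    by (auto intro!: derivative_eq_intros)
  from DERIV_neg_dec_right[OF this] assms obtain d where d: "d > 0"
    "\<And>h. \<lbrakk>h > 0; h < d\<rbrakk> \<Longrightarrow> (1 + (exp h - 1) * a) * exp (- (h * b)) < 1"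
    by auto
  from d(2)[of "d / 2"] d(1) show ?thesis by (intro exI[of _ "d / 2"]) auto
qed

theorem lemma2p1:
  fixes M :: "'a measure"
    and l\<^sub>R :: "nat \<Rightarrow> 'a \<Rightarrow> nat"
    and p :: "nat \<Rightarrow> nat \<Rightarrow> nat \<Rightarrow> real"
    and p\<^sub>1 :: real
  assumes "inhomogeneous_markov_chain M {0, 1} p l\<^sub>R"
    and "p\<^sub>1 \<in> {0<..<1}"
    and "\<forall>q\<in>{0, 1}. \<forall>i. p q 1 i \<le> p\<^sub>1"
  shows "\<forall>\<rho>\<^sub>R\<in>{p\<^sub>1<..<1}.
    (\<lambda>k::nat. \<P>(\<omega> in M. real (\<Sum>i<k. l\<^sub>R i \<omega>) > \<rho>\<^sub>R * real k)) summable_on {1..}"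
proof
  fix \<rho> assume \<rho>: "\<rho> \<in> {p\<^sub>1<..<1}"
  interpret inhomogeneous_markov_chain M "{0, 1}" p l\<^sub>R by (rule assms(1))
  let ?P = "\<lambda>k::nat. \<P>(\<omega> in M. real (\<Sum>i<k. l\<^sub>R i \<omega>) > \<rho> * real k)"
  obtain t where t: "t > 0" "(1 + (exp t - 1) * p\<^sub>1) * exp (- (t * \<rho>)) < 1"
    using exists_chernoff_exponent[of p\<^sub>1 \<rho>] \<rho> by auto
  define z where "z = exp t"
  define m where "m = 1 + (z - 1) * p\<^sub>1"
  \<comment> \<open>The geometric ratio: moment growth \<open>m\<close> per step against the
    threshold's growth \<open>exp (t * \<rho>)\<close>.\<close>
  define q where "q = m * exp (- (t * \<rho>))"
  have z: "1 \<le> z" using t(1) by (simp add: z_def)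
  have m: "1 \<le> m" using z assms(2) by (simp add: m_def)
  have q: "0 \<le> q" "q < 1" using m t(2) by (auto simp: q_def m_def z_def)
  have bound: "?P (Suc i) \<le> z * q ^ Suc i" for i
  proof -
    let ?Z = "\<lambda>\<omega>. z ^ (\<Sum>j\<le>i. l\<^sub>R j \<omega>)" and ?a = "exp (t * \<rho> * real (Suc i))"
    have E: "integrable M ?Z" "expectation ?Z \<le> z * m ^ i"
      using exponential_moment_le[OF assms(1), of p\<^sub>1 z i] assms(2,3) z by (auto simp: m_def)
    \<comment> \<open>As \<open>t > 0\<close>, multiplying by \<open>t\<close> and exponentiating
      preserves the inequality; the first \<open>Suc i\<close> terms are those with index at most
      \<open>i\<close>.\<close>
    have "?P (Suc i) \<le> \<P>(\<omega> in M. ?a \<le> ?Z \<omega>)"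
    proof (rule finite_measure_mono)
      show "{\<omega> \<in> space M. \<rho> * real (Suc i) < real (\<Sum>j<Suc i. l\<^sub>R j \<omega>)}
          \<subseteq> {\<omega> \<in> space M. ?a \<le> ?Z \<omega>}"
        using t(1)
        by (auto simp: z_def lessThan_Suc_atMost exp_of_nat2_mult[symmetric] mult.assoc
            simp del: of_nat_sum of_nat_Suc)
      show "{\<omega> \<in> space M. ?a \<le> ?Z \<omega>} \<in> events"
        using borel_measurable_integrable[OF E(1)] by measurable
    qed
    also have "\<dots> \<le> expectation ?Z / ?a"
      by (rule integral_Markov_inequality_measure[OF E(1), of "{}"]) (use z in auto)
    \<comment> \<open>Only \<open>i\<close> transitions occur among \<open>Suc i\<close> states; one
      more factor \<open>m \<ge> 1\<close> matches the exponent of the threshold and yields a power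
      of \<open>q\<close>.\<close>
    also have "\<dots> \<le> z * m ^ Suc i / ?a"
    proof (rule divide_right_mono)
      have "m ^ i \<le> m ^ Suc i" using m by (intro power_increasing) auto
      with E(2) z show "expectation ?Z \<le> z * m ^ Suc i"
        by (meson mult_left_mono order_trans zero_le_one)
    qed simp
    also have "\<dots> = z * q ^ Suc i"
    proof -
      have "q = m / exp (t * \<rho>)" by (simp add: q_def exp_minus divide_inverse)
      then show ?thesis by (simp only: exp_of_nat2_mult power_divide times_divide_eq_right)
    qed
    finally show ?thesis .
  qed
  have "summable (\<lambda>i. z * q ^ Suc i)"
    using q by (intro summable_mult) (simp add: summable_Suc_iff summable_geometric)
  then have "summable (\<lambda>i. ?P (Suc i))"
    by (rule summable_comparison_test') (use bound in auto)
  \<comment> \<open>The index shift restores the single term \<open>k = 0\<close>. Absolute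
    summability then gives unordered summability over all naturals, hence over
    \<open>{1..}\<close>.\<close>
  then have "summable (\<lambda>k. norm (?P k))"
    by (subst summable_Suc_iff[symmetric]) simp
  then show "?P summable_on {1..}"
    by (rule summable_on_subset_banach[OF norm_summable_imp_summable_on]) simp
qed

end
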